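(* Let $\mathbf{f}_1, \mathbf{f}_2 \in \mathbb{R}^d$ be orthonormal features, i.e. $\mathbf{f}_1 \cdot \mathbf{f}_2 = 0$ and $\|\mathbf{f}_1\|_2 = \|\mathbf{f}_2\|_2 = 1$. Suppose a random input $\mathbf{x}$ is generated so that $\mathbf{f}_1$ fires alone with probability $P_1$, $\mathbf{f}_2$ fires alone with probability $P_2$, both fire together with probability $P_{12}$, and neither fires with the remaining probability, where $P_1 + P_2 + P_{12} \le 1$. Consider tied sparse autoencoders with 2 latents $\mathbf{l}_1, \mathbf{l}_2 \in \mathbb{R}^d$ (that is, $\mathbf{W}_{\mathrm{enc}} = \mathbf{W}_{\mathrm{dec}}^{T}$ with $\mathbf{W}_{\mathrm{dec}} = [\mathbf{l}_1, \mathbf{l}_2]$), with no biases, that can fire at most 1 latent per input. Assume that this is less than the true L0 of the data, i.e. the expected number of active features satisfies $P_1 + P_2 + 2P_{12} > 1$. Then any such sparse autoencoder minimizing the expected mean squared error $\mathbb{E}\,\|\mathbf{x} - \hat{\mathbf{x}}\|_2^2$ has latents that mix $\mathbf{f}_1$ and $\mathbf{f}_2$ rather than learning them separately; that is, at least one latent $\mathbf{l}_i$ satisfies both $\mathbf{l}_i \cdot \mathbf{f}_1 \neq 0$ and $\mathbf{l}_i \cdot \mathbf{f}_2 \neq 0$.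
   Context: When a feature $\mathbf{f}_k$ fires it does so with a (possibly random) magnitude $m_k > 0$ with finite second moment. The input is $\mathbf{x} = m_1 \mathbf{f}_1$ if only $\mathbf{f}_1$ fires, $\mathbf{x} = m_2 \mathbf{f}_2$ if only $\mathbf{f}_2$ fires, $\mathbf{x} = m_1 \mathbf{f}_1 + m_2 \mathbf{f}_2$ if both fire, and $\mathbf{x} = 0$ if neither fires. The tied, bias-free sparse autoencoder with latents $\mathbf{l}_1, \mathbf{l}_2$ and at most one firing latent (L0 $=1$) works as follows: the single active latent $\mathbf{l}_i$ is the one with the largest squared projection $|\mathbf{l}_i \cdot \mathbf{x}|^2$ (Top-1 selection, ties broken by a fixed rule), and the reconstruction is $\hat{\mathbf{x}} = (\mathbf{l}_i \cdot \mathbf{x})\, \mathbf{l}_i$. The "disentangled" (separate) solution is $\{\mathbf{l}_1, \mathbf{l}_2\} = \{\mathbf{f}_1, \mathbf{f}_2\}$. *)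

theory Defs
  imports "HOL-Probability.Probability"
begin

text \<open>
  \<open>A1\<close> and \<open>A2\<close> are the events that the first and the second feature fires, \<open>m1\<close> and \<open>m2\<close> the
  magnitudes. The value of \<open>mk\<close> outside \<open>Ak\<close> is irrelevant.
\<close>

definition feature_input ::
  "real ^ 'd \<Rightarrow> real ^ 'd \<Rightarrow> 'w set \<Rightarrow> 'w set \<Rightarrow> ('w \<Rightarrow> real) \<Rightarrow> ('w \<Rightarrow> real) \<Rightarrow> 'w \<Rightarrow> real ^ 'd"
where
  "feature_input f1 f2 A1 A2 m1 m2 \<omega> =
     (if \<omega> \<in> A1 \<and> \<omega> \<in> A2 then m1 \<omega> *\<^sub>R f1 + m2 \<omega> *\<^sub>R f2
      else if \<omega> \<in> A1 then m1 \<omega> *\<^sub>R f1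
      else if \<omega> \<in> A2 then m2 \<omega> *\<^sub>R f2
      else 0)"

text \<open>
  The argument \<open>t\<close> is the latent preferred in case of a tie. The index type is the two-element
  numeral type, whose elements are \<open>1\<close> and \<open>2\<close>.
\<close>

definition top1_index :: "2 \<Rightarrow> real ^ 2 \<Rightarrow> 2" where
  "top1_index t z =
     (if (z $ 1)\<^sup>2 > (z $ 2)\<^sup>2 then 1
      else if (z $ 1)\<^sup>2 < (z $ 2)\<^sup>2 then 2
      else t)"

definition top1 :: "2 \<Rightarrow> real ^ 2 \<Rightarrow> real ^ 2" where
  "top1 t z = (\<chi> j. if j = top1_index t z then z $ j else 0)"

text \<open>
  The latents \<open>l\<^sub>1, l\<^sub>2\<close> of the tied autoencoder are the columns of the decoder matrix \<open>W\<close>; its encoder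
  matrix is the transpose, so the pre-activations are the projections \<open>l\<^sub>i \<bullet> x\<close>. The tie-breaking
  rule may depend on the autoencoder and on the input.
\<close>

definition tied_sae :: "(real ^ 2 ^ 'd \<Rightarrow> real ^ 'd \<Rightarrow> 2) \<Rightarrow> real ^ 2 ^ 'd \<Rightarrow> real ^ 'd \<Rightarrow> real ^ 'd"
where
  "tied_sae tie W x = W *v top1 (tie W x) (transpose W *v x)"

lemma tied_sae_eq:
  "tied_sae tie W x =
     (let i = top1_index (tie W x) (\<chi> j. column j W \<bullet> x) in (column i W \<bullet> x) *\<^sub>R column i W)"
proof -
  have z: "transpose W *v x = (\<chi> j. column j W \<bullet> x)"
    by (simp add: vec_eq_iff matrix_vector_mult_def transpose_def column_def inner_vec_def)
  show ?thesis
    unfolding tied_sae_def z top1_def Let_def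
    by (simp add: vec_eq_iff matrix_vector_mult_def column_def if_distrib cong: if_cong)
qed

definition expected_mse ::
  "'w measure \<Rightarrow> ('w \<Rightarrow> real ^ 'd) \<Rightarrow> (real ^ 2 ^ 'd \<Rightarrow> real ^ 'd \<Rightarrow> 2) \<Rightarrow> real ^ 2 ^ 'd \<Rightarrow> real"
where
  "expected_mse M X tie W = (\<integral>\<omega>. (norm (X \<omega> - tied_sae tie W (X \<omega>)))\<^sup>2 \<partial>M)"

end

theory Submission
  imports Defs
begin

text \<open>
  On an input \<open>a f\<^sub>1 + b f\<^sub>2\<close> a latent orthogonal to \<open>f\<^sub>1\<close> (or \<open>f\<^sub>2\<close>) leaves the component \<open>a\<close> (or \<open>b\<close>)
  unreconstructed, so an autoencoder without a mixed latent has loss at least \<open>E min(a\<^sup>2, b\<^sup>2)\<close>. Tilting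
  the first latent of the separate solution by a small angle with tangent \<open>t\<close> towards \<open>f\<^sub>2\<close> changes
  that value by at most a multiple of \<open>t\<^sup>2 E a\<^sup>2 - 2 t E(a b; b \<le> a)\<close>. If the features fire together
  with positive probability, this is negative for small \<open>t > 0\<close>, possibly after exchanging the
  features.
\<close>

section \<open>Residuals on a single input\<close>

text \<open>Packages what the bounds use of Top-1 selection. In a tie both latents have the largest
  squared projection, so maximality holds under every tie-breaking rule.\<close>

lemma tied_sae_cases:
  obtains (col) i where "tied_sae tie W x = (column i W \<bullet> x) *\<^sub>R column i W"
    and "\<And>j. (column j W \<bullet> x)\<^sup>2 \<le> (column i W \<bullet> x)\<^sup>2"
proof -
  let ?i = "top1_index (tie W x) (\<chi> j. column j W \<bullet> x)"
  have "(column j W \<bullet> x)\<^sup>2 \<le> (column ?i W \<bullet> x)\<^sup>2" for j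
    using exhaust_2[of j] exhaust_2[of "tie W x"] by (auto simp: top1_index_def)
  with col show thesis
    by (simp add: tied_sae_eq Let_def)
qed

lemma norm_residual_unit:
  fixes l x :: "'a::real_inner"
  assumes "norm l = 1"
  shows "(norm (x - (l \<bullet> x) *\<^sub>R l))\<^sup>2 = (norm x)\<^sup>2 - (l \<bullet> x)\<^sup>2"
proof -
  have "l \<bullet> l = 1"
    using assms by (simp add: dot_square_norm)
  then show ?thesis
    unfolding power2_norm_eq_inner
    by (simp add: inner_diff_left inner_diff_right inner_commute power2_eq_square)
qed

lemma norm_combination_orthonormal:
  fixes f g :: "'a::real_inner"
  assumes "f \<bullet> g = 0" "norm f = 1" "norm g = 1"
  shows "(norm (a *\<^sub>R f + b *\<^sub>R g))\<^sup>2 = a\<^sup>2 + b\<^sup>2"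
  using assms unfolding power2_norm_eq_inner
  by (simp add: norm_eq_1 inner_simps inner_commute power2_eq_square)

text \<open>A multiple of \<open>l\<close> adds nothing along \<open>f\<close>, so the residual
  keeps the full coefficient \<open>a\<close> in that direction; Cauchy-Schwarz against the unit
  vector \<open>f\<close> turns this into a norm bound.\<close>

lemma residual_ge_orthogonal:
  fixes f g l :: "'a::real_inner"
  assumes "f \<bullet> g = 0" "norm f = 1" "l \<bullet> f = 0"
  shows "a\<^sup>2 \<le> (norm (a *\<^sub>R f + b *\<^sub>R g - c *\<^sub>R l))\<^sup>2"
proof -
  have "f \<bullet> (a *\<^sub>R f + b *\<^sub>R g - c *\<^sub>R l) = a"
    using assms by (simp add: inner_simps norm_eq_1 inner_commute[of f l])
  then have "\<bar>a\<bar> \<le> norm (a *\<^sub>R f + b *\<^sub>R g - c *\<^sub>R l)"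
    using Cauchy_Schwarz_ineq2[of f "a *\<^sub>R f + b *\<^sub>R g - c *\<^sub>R l"] assms(2) by simp
  then show ?thesis
    by (simp add: abs_le_square_iff[symmetric])
qed

text \<open>Whichever latent fires, it is orthogonal to one feature and loses that coordinate
  entirely. The latents may have any length, so every unmixed autoencoder faces this bound.\<close>

lemma unmixed_residual_ge:
  assumes "f \<bullet> g = 0" "norm f = 1" "norm g = 1"
    and unmixed: "\<And>i. column i W \<bullet> f = 0 \<or> column i W \<bullet> g = 0"
    and x: "x = a *\<^sub>R f + b *\<^sub>R g"
  shows "min (a\<^sup>2) (b\<^sup>2) \<le> (norm (x - tied_sae tie W x))\<^sup>2"
proof (cases rule: tied_sae_cases[of tie W x])
  case (col i)
  show ?thesis
    using unmixed[of i]
  proof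
    assume "column i W \<bullet> f = 0"
    then show ?thesis
      using residual_ge_orthogonal[of f g "column i W" a b "column i W \<bullet> x"] assms col(1)
      by (simp add: min_le_iff_disj)
  next
    assume "column i W \<bullet> g = 0"
    then show ?thesis
      using residual_ge_orthogonal[of g f "column i W" b a "column i W \<bullet> x"] assms col(1)
      by (simp add: min_le_iff_disj inner_commute add.commute)
  qed
qed

text \<open>For unit latents a larger squared projection means a smaller residual, so Top-1 selects
  the best latent. An upper bound may therefore be computed with whichever \<open>j\<close> is
  convenient.\<close>

lemma unit_residual_le:
  assumes "\<And>i. norm (column i W) = 1"
  shows "(norm (x - tied_sae tie W x))\<^sup>2 \<le> (norm x)\<^sup>2 - (column j W \<bullet> x)\<^sup>2"
proof (cases rule: tied_sae_cases[of tie W x])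
  case (col i)
  then show ?thesis
    using norm_residual_unit[OF assms, of x i] col(2)[of j] by simp
qed

section \<open>Integrability of the loss\<close>

text \<open>A crude domination by a multiple of the input norm. Summing over both latents makes the
  constant independent of which one fires.\<close>

lemma norm_residual_le:
  "norm (x - tied_sae tie W x) \<le> (1 + (\<Sum>i\<in>UNIV. (norm (column i W))\<^sup>2)) * norm x"
proof (cases rule: tied_sae_cases[of tie W x])
  case (col i)
  let ?l = "column i W"
  have "norm (x - tied_sae tie W x) \<le> norm x + norm ((?l \<bullet> x) *\<^sub>R ?l)"
    unfolding col(1) by (rule norm_triangle_ineq4)
  also have "\<dots> \<le> norm x + (norm ?l)\<^sup>2 * norm x"
    using mult_right_mono[OF Cauchy_Schwarz_ineq2[of ?l x], of "norm ?l"]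
    by (simp add: power2_eq_square mult_ac)
  also have "\<dots> = (1 + (norm ?l)\<^sup>2) * norm x"
    by (simp add: algebra_simps)
  also have "(norm ?l)\<^sup>2 \<le> (\<Sum>i\<in>UNIV. (norm (column i W))\<^sup>2)"
    by (rule member_le_sum) auto
  finally show ?thesis
    by (simp add: mult_right_mono)
qed

lemma tied_sae_measurable:
  assumes tie: "tie W \<in> borel \<rightarrow>\<^sub>M count_space UNIV"
  shows "tied_sae tie W \<in> borel_measurable borel"
proof -
  let ?z = "\<lambda>i x. (column i W \<bullet> x)\<^sup>2"
  have eq: "tied_sae tie W = (\<lambda>x.
      if ?z 1 x > ?z 2 x \<or> \<not> ?z 1 x < ?z 2 x \<and> tie W x = 1
      then (column 1 W \<bullet> x) *\<^sub>R column 1 W else (column 2 W \<bullet> x) *\<^sub>R column 2 W)"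
  proof
    show "tied_sae tie W x = (if ?z 1 x > ?z 2 x \<or> \<not> ?z 1 x < ?z 2 x \<and> tie W x = 1
      then (column 1 W \<bullet> x) *\<^sub>R column 1 W else (column 2 W \<bullet> x) *\<^sub>R column 2 W)" for x
      using exhaust_2[of "tie W x"] by (auto simp: tied_sae_eq Let_def top1_index_def)
  qed
  have [measurable]: "Measurable.pred borel (\<lambda>x. tie W x = 1)"
    using tie by measurable
  show ?thesis
    unfolding eq by measurable
qed

text \<open>The integral of a non-integrable function is 0 by default, so losses can be compared by
  monotonicity only once integrability is known.\<close>

lemma integrable_residual:
  assumes "tie W \<in> borel \<rightarrow>\<^sub>M count_space UNIV"
    and X [measurable]: "X \<in> borel_measurable M"
    and int: "integrable M (\<lambda>\<omega>. (norm (X \<omega>))\<^sup>2)"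
  shows "integrable M (\<lambda>\<omega>. (norm (X \<omega> - tied_sae tie W (X \<omega>)))\<^sup>2)"
proof (rule Bochner_Integration.integrable_bound)
  let ?C = "1 + (\<Sum>i\<in>UNIV. (norm (column i W))\<^sup>2)"
  show "integrable M (\<lambda>\<omega>. ?C\<^sup>2 * (norm (X \<omega>))\<^sup>2)"
    using int by simp
  have [measurable]: "tied_sae tie W \<in> borel_measurable borel"
    by (rule tied_sae_measurable) fact
  show "(\<lambda>\<omega>. (norm (X \<omega> - tied_sae tie W (X \<omega>)))\<^sup>2) \<in> borel_measurable M"
    by measurable
  show "AE \<omega> in M. norm ((norm (X \<omega> - tied_sae tie W (X \<omega>)))\<^sup>2) \<le> norm (?C\<^sup>2 * (norm (X \<omega>))\<^sup>2)"
    using power_mono[OF norm_residual_le norm_ge_zero, of _ tie W 2]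
    by (simp add: power_mult_distrib)
qed

lemma integrable_mult_of_squares:
  fixes a b :: "'w \<Rightarrow> real"
  assumes [measurable]: "a \<in> borel_measurable M" "b \<in> borel_measurable M"
    and "integrable M (\<lambda>\<omega>. (a \<omega>)\<^sup>2)" "integrable M (\<lambda>\<omega>. (b \<omega>)\<^sup>2)"
  shows "integrable M (\<lambda>\<omega>. a \<omega> * b \<omega>)"
proof (rule Bochner_Integration.integrable_bound)
  show "integrable M (\<lambda>\<omega>. (a \<omega>)\<^sup>2 + (b \<omega>)\<^sup>2)"
    using assms by simp
  have "\<bar>x * y\<bar> \<le> x\<^sup>2 + y\<^sup>2" for x y :: real
    using sum_squares_bound[of "\<bar>x\<bar>" "\<bar>y\<bar>"] abs_ge_zero[of "x * y"]
    unfolding abs_mult power2_abs by linarith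
  then show "AE \<omega> in M. norm (a \<omega> * b \<omega>) \<le> norm ((a \<omega>)\<^sup>2 + (b \<omega>)\<^sup>2)"
    by simp
qed measurable

section \<open>Improving on the separate solution by a tilt\<close>

text \<open>Bound the residual by that of the tilted latent if \<open>b \<le> a\<close>, and by that
  of the unchanged latent \<open>g\<close> otherwise. The first case yields the gain linear in
  \<open>t\<close>; in the second the correction term is nonnegative and does no harm.\<close>

lemma tilted_residual_le:
  assumes fg: "f \<bullet> g = 0" "norm f = 1" "norm g = 1"
    and W: "column 1 W = (1 / sqrt (1 + t\<^sup>2)) *\<^sub>R (f + t *\<^sub>R g)" "column 2 W = g"
    and x: "x = a *\<^sub>R f + b *\<^sub>R g" and "0 \<le> a" "0 \<le> b"
  shows "(norm (x - tied_sae tie W x))\<^sup>2 \<le>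
    min (a\<^sup>2) (b\<^sup>2) + (t\<^sup>2 * a\<^sup>2 - 2 * t * (if b \<le> a then a * b else 0)) / (1 + t\<^sup>2)"
proof -
  have pos: "1 + t\<^sup>2 > 0"
    by (simp add: add_pos_nonneg)
  have n: "(norm (f + t *\<^sub>R g))\<^sup>2 = 1 + t\<^sup>2"
    using norm_combination_orthonormal[OF fg, of 1 t] by simp
  then have "norm (f + t *\<^sub>R g) = sqrt (1 + t\<^sup>2)"
    by (metis norm_ge_zero real_sqrt_unique)
  then have unit: "norm (column i W) = 1" for i
    using exhaust_2[of i] W fg pos by auto
  have "(f + t *\<^sub>R g) \<bullet> x = a + t * b"
    using fg by (simp add: x inner_simps norm_eq_1 inner_commute[of g f])
  then have p1: "(column 1 W \<bullet> x)\<^sup>2 = (a + t * b)\<^sup>2 / (1 + t\<^sup>2)"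
    using pos by (simp add: W power_divide)
  have p2: "column 2 W \<bullet> x = b"
    using fg by (simp add: W x inner_simps norm_eq_1 inner_commute[of g f])
  have nx: "(norm x)\<^sup>2 = a\<^sup>2 + b\<^sup>2"
    unfolding x using norm_combination_orthonormal[OF fg] .
  show ?thesis
  proof (cases "b \<le> a")
    case True
    have "(norm (x - tied_sae tie W x))\<^sup>2 \<le> a\<^sup>2 + b\<^sup>2 - (a + t * b)\<^sup>2 / (1 + t\<^sup>2)"
      using unit_residual_le[OF unit, where x = x and tie = tie and j = 1] p1 nx by simp
    also have "\<dots> = b\<^sup>2 + (t\<^sup>2 * a\<^sup>2 - 2 * t * (a * b)) / (1 + t\<^sup>2) - t\<^sup>2 * b\<^sup>2 / (1 + t\<^sup>2)"
    proof -
      have "(a + t * b)\<^sup>2 + (t\<^sup>2 * a\<^sup>2 - 2 * t * (a * b)) - t\<^sup>2 * b\<^sup>2 = a\<^sup>2 * (1 + t\<^sup>2)"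
        by (simp add: algebra_simps power2_eq_square)
      then have "a\<^sup>2 = ((a + t * b)\<^sup>2 + (t\<^sup>2 * a\<^sup>2 - 2 * t * (a * b)) - t\<^sup>2 * b\<^sup>2) / (1 + t\<^sup>2)"
        using pos by simp
      then show ?thesis
        unfolding add_divide_distrib diff_divide_distrib by linarith
    qed
    \<comment> \<open>Dropping the last term leaves only multiples of \<open>a\<^sup>2\<close> and
      \<open>a * b\<close>, whose expectations become \<open>E\<close> and \<open>K\<close>
      below.\<close>
    also have "\<dots> \<le> b\<^sup>2 + (t\<^sup>2 * a\<^sup>2 - 2 * t * (a * b)) / (1 + t\<^sup>2)"
      using pos by simp
    also have "b\<^sup>2 = min (a\<^sup>2) (b\<^sup>2)"
      using True \<open>0 \<le> b\<close> by (simp add: min_def power_mono antisym)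
    finally show ?thesis
      using True by simp
  next
    case False
    then have "a\<^sup>2 = min (a\<^sup>2) (b\<^sup>2)"
      using \<open>0 \<le> a\<close> by (simp add: min_def power_mono)
    moreover have "(norm (x - tied_sae tie W x))\<^sup>2 \<le> a\<^sup>2"
      using unit_residual_le[OF unit, where x = x and tie = tie and j = 2] p2 nx by simp
    moreover have "0 \<le> t\<^sup>2 * a\<^sup>2 / (1 + t\<^sup>2)"
      using pos by simp
    ultimately show ?thesis
      using False by (simp add: add_increasing2)
  qed
qed

lemma exists_better_than_separate:
  fixes f g :: "real ^ 'd"
  assumes fg: "f \<bullet> g = 0" "norm f = 1" "norm g = 1"
    and [measurable]: "a \<in> borel_measurable M" "b \<in> borel_measurable M"
    and nonneg: "AE \<omega> in M. 0 \<le> a \<omega>" "AE \<omega> in M. 0 \<le> b \<omega>"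
    and int: "integrable M (\<lambda>\<omega>. (a \<omega>)\<^sup>2)" "integrable M (\<lambda>\<omega>. (b \<omega>)\<^sup>2)"
    and tie: "\<And>V. tie V \<in> borel \<rightarrow>\<^sub>M count_space UNIV"
    and not_null: "\<not> (AE \<omega> in M. \<not> (0 < b \<omega> \<and> b \<omega> \<le> a \<omega>))"
  shows "\<exists>V. expected_mse M (\<lambda>\<omega>. a \<omega> *\<^sub>R f + b \<omega> *\<^sub>R g) tie V
    < (\<integral>\<omega>. min ((a \<omega>)\<^sup>2) ((b \<omega>)\<^sup>2) \<partial>M)"
proof -
  let ?ab = "\<lambda>\<omega>. if b \<omega> \<le> a \<omega> then a \<omega> * b \<omega> else 0"
  define K where "K = (\<integral>\<omega>. ?ab \<omega> \<partial>M)"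
  define E where "E = (\<integral>\<omega>. (a \<omega>)\<^sup>2 \<partial>M)"
  \<comment> \<open>Small enough that the cost \<open>t\<^sup>2 * E\<close> stays below the gain
    \<open>2 * t * K\<close>; adding 1 keeps the denominator positive when only
    \<open>0 \<le> E\<close> is known.\<close>
  define t where "t = K / (E + 1)"
  have int_ab: "integrable M ?ab"
    by (rule Bochner_Integration.integrable_bound[where f = "\<lambda>\<omega>. a \<omega> * b \<omega>"])
       (auto intro: integrable_mult_of_squares int)
  have ab_nonneg: "AE \<omega> in M. 0 \<le> ?ab \<omega>"
    using nonneg by eventually_elim auto
  \<comment> \<open>A nonnegative integrand with zero integral vanishes almost everywhere, but
    \<open>a * b\<close> is positive wherever \<open>0 < b\<close> and
    \<open>b \<le> a\<close>.\<close>
  have "K \<noteq> 0"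
  proof
    assume "K = 0"
    then have "AE \<omega> in M. ?ab \<omega> = 0"
      using integral_nonneg_eq_0_iff_AE[OF int_ab ab_nonneg] by (simp add: K_def)
    then have "AE \<omega> in M. \<not> (0 < b \<omega> \<and> b \<omega> \<le> a \<omega>)"
      by eventually_elim (auto split: if_splits)
    with not_null show False by contradiction
  qed
  moreover have "0 \<le> K"
    unfolding K_def by (rule integral_nonneg_AE) (rule ab_nonneg)
  ultimately have K: "0 < K" by simp
  have E: "0 \<le> E"
    by (simp add: E_def)
  have t: "0 < t" "t * E < K"
    using K E by (simp_all add: t_def field_simps add_nonneg_pos)
  then have "t * (t * E) < t * (2 * K)"
    using K by (intro mult_strict_left_mono) auto
  then have neg: "(t\<^sup>2 * E - 2 * t * K) / (1 + t\<^sup>2) < 0"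
    by (intro divide_neg_pos) (simp_all add: power2_eq_square mult_ac add_pos_nonneg)
  \<comment> \<open>The factor \<open>1 / sqrt (1 + t\<^sup>2)\<close> makes the tilted column a
    unit vector.\<close>
  define V :: "real ^ 2 ^ 'd" where
    "V = (\<chi> k j. (if j = 1 then (1 / sqrt (1 + t\<^sup>2)) *\<^sub>R (f + t *\<^sub>R g) else g) $ k)"
  have V: "column 1 V = (1 / sqrt (1 + t\<^sup>2)) *\<^sub>R (f + t *\<^sub>R g)" "column 2 V = g"
    by (simp_all add: V_def column_def vec_eq_iff)
  let ?X = "\<lambda>\<omega>. a \<omega> *\<^sub>R f + b \<omega> *\<^sub>R g"
  let ?m = "\<lambda>\<omega>. min ((a \<omega>)\<^sup>2) ((b \<omega>)\<^sup>2)"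
  have int_m: "integrable M ?m"
    using int by (rule integrable_min)
  have "expected_mse M ?X tie V \<le>
      (\<integral>\<omega>. ?m \<omega> + (t\<^sup>2 * (a \<omega>)\<^sup>2 - 2 * t * ?ab \<omega>) / (1 + t\<^sup>2) \<partial>M)"
    unfolding expected_mse_def
  proof (rule integral_mono_AE)
    show "integrable M (\<lambda>\<omega>. (norm (?X \<omega> - tied_sae tie V (?X \<omega>)))\<^sup>2)"
      using int by (intro integrable_residual tie) (simp_all add: norm_combination_orthonormal[OF fg])
    show "integrable M (\<lambda>\<omega>. ?m \<omega> + (t\<^sup>2 * (a \<omega>)\<^sup>2 - 2 * t * ?ab \<omega>) / (1 + t\<^sup>2))"
      using int int_m int_ab
      by (intro Bochner_Integration.integrable_add integrable_divide Bochner_Integration.integrable_diff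
          integrable_mult_right)
    show "AE \<omega> in M. (norm (?X \<omega> - tied_sae tie V (?X \<omega>)))\<^sup>2
        \<le> ?m \<omega> + (t\<^sup>2 * (a \<omega>)\<^sup>2 - 2 * t * ?ab \<omega>) / (1 + t\<^sup>2)"
      using nonneg by eventually_elim (rule tilted_residual_le[OF fg V refl])
  qed
  also have "\<dots> = (\<integral>\<omega>. ?m \<omega> \<partial>M) + (t\<^sup>2 * E - 2 * t * K) / (1 + t\<^sup>2)"
    unfolding E_def K_def using int int_m int_ab
    by (subst Bochner_Integration.integral_add) (auto simp: Bochner_Integration.integral_diff)
  also have "\<dots> < (\<integral>\<omega>. ?m \<omega> \<partial>M)"
    using neg by simp
  finally show ?thesis ..
qed

section \<open>Minimizers have a mixed latent\<close>

text \<open>Magnitudes cut off outside their firing events serve as coordinates, which merges the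
  four firing cases into one linear form.\<close>

lemma feature_input_eq:
  "feature_input f1 f2 A1 A2 m1 m2 =
    (\<lambda>\<omega>. (indicator A1 \<omega> * m1 \<omega>) *\<^sub>R f1 + (indicator A2 \<omega> * m2 \<omega>) *\<^sub>R f2)"
  by (auto simp: feature_input_def fun_eq_iff)

theorem theoremF1:
  fixes M :: "'w measure"
    and f1 f2 :: "real ^ 'd"
    and A1 A2 :: "'w set"
    and m1 m2 :: "'w \<Rightarrow> real"
    and P1 P2 P12 :: real
    and tie :: "real ^ 2 ^ 'd \<Rightarrow> real ^ 'd \<Rightarrow> 2"
    and W :: "real ^ 2 ^ 'd"
  assumes "prob_space M"
    and "f1 \<bullet> f2 = 0" and "norm f1 = 1" and "norm f2 = 1"
    and "A1 \<in> sets M" and "A2 \<in> sets M"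
    and "m1 \<in> borel_measurable M" and "m2 \<in> borel_measurable M"
    and "AE \<omega> in M. \<omega> \<in> A1 \<longrightarrow> m1 \<omega> > 0"
    and "AE \<omega> in M. \<omega> \<in> A2 \<longrightarrow> m2 \<omega> > 0"
    and "set_integrable M A1 (\<lambda>\<omega>. (m1 \<omega>)\<^sup>2)"
    and "set_integrable M A2 (\<lambda>\<omega>. (m2 \<omega>)\<^sup>2)"
    and "measure M (A1 - A2) = P1"
    and "measure M (A2 - A1) = P2"
    and "measure M (A1 \<inter> A2) = P12"
    and "P1 + P2 + P12 \<le> 1"
    and "P1 + P2 + 2 * P12 > 1"
    and "\<And>V. tie V \<in> borel \<rightarrow>\<^sub>M count_space UNIV"
    and "is_arg_min (expected_mse M (feature_input f1 f2 A1 A2 m1 m2) tie) (\<lambda>_. True) W"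
  shows "\<exists>i. column i W \<bullet> f1 \<noteq> 0 \<and> column i W \<bullet> f2 \<noteq> 0"
proof (rule ccontr)
  assume "\<not> (\<exists>i. column i W \<bullet> f1 \<noteq> 0 \<and> column i W \<bullet> f2 \<noteq> 0)"
  then have unmixed: "\<And>i. column i W \<bullet> f1 = 0 \<or> column i W \<bullet> f2 = 0"
    by blast
  interpret prob_space M by fact
  note fg = assms(2-4) and tie = assms(18)
  note [measurable] = assms(5-8)
  define a where "a = (\<lambda>\<omega>. indicator A1 \<omega> * m1 \<omega>)"
  define b where "b = (\<lambda>\<omega>. indicator A2 \<omega> * m2 \<omega>)"
  let ?X = "\<lambda>\<omega>. a \<omega> *\<^sub>R f1 + b \<omega> *\<^sub>R f2"
  have X: "feature_input f1 f2 A1 A2 m1 m2 = ?X"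
    by (simp add: feature_input_eq a_def b_def)
  have ab [measurable]: "a \<in> borel_measurable M" "b \<in> borel_measurable M"
    by (simp_all add: a_def b_def)
  have sq: "(indicator A \<omega> * m \<omega>)\<^sup>2 = indicator A \<omega> *\<^sub>R (m \<omega>)\<^sup>2"
    for A :: "'w set" and m :: "'w \<Rightarrow> real" and \<omega>
    by (simp add: indicator_def)
  have int: "integrable M (\<lambda>\<omega>. (a \<omega>)\<^sup>2)" "integrable M (\<lambda>\<omega>. (b \<omega>)\<^sup>2)"
    using assms(11,12) unfolding a_def b_def sq set_integrable_def .
  have nonneg: "AE \<omega> in M. 0 \<le> a \<omega>" "AE \<omega> in M. 0 \<le> b \<omega>"
    using assms(9,10) by (auto simp: a_def b_def indicator_def elim: eventually_mono)
  have lower: "(\<integral>\<omega>. min ((a \<omega>)\<^sup>2) ((b \<omega>)\<^sup>2) \<partial>M) \<le> expected_mse M ?X tie W"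
    unfolding expected_mse_def
  proof (rule integral_mono)
    show "integrable M (\<lambda>\<omega>. min ((a \<omega>)\<^sup>2) ((b \<omega>)\<^sup>2))"
      using int by (rule integrable_min)
    show "integrable M (\<lambda>\<omega>. (norm (?X \<omega> - tied_sae tie W (?X \<omega>)))\<^sup>2)"
      using int by (intro integrable_residual tie) (simp_all add: norm_combination_orthonormal[OF fg])
  qed (rule unmixed_residual_ge[OF fg unmixed refl])
  have opt: "\<not> expected_mse M ?X tie V < expected_mse M ?X tie W" for V
    using assms(19) by (simp add: is_arg_min_def X)
  have not_better: "\<not> (\<exists>V. expected_mse M ?X tie V < (\<integral>\<omega>. min ((a \<omega>)\<^sup>2) ((b \<omega>)\<^sup>2) \<partial>M))"
    using opt lower by (meson less_le_trans)
  \<comment> \<open>Otherwise tilting \<open>f1\<close> towards \<open>f2\<close> would beat the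
    lower bound for \<open>W\<close>, contradicting its optimality.\<close>
  have "AE \<omega> in M. \<not> (0 < b \<omega> \<and> b \<omega> \<le> a \<omega>)"
    using exists_better_than_separate[where tie = tie, OF fg ab nonneg int tie] not_better by blast
  moreover have "AE \<omega> in M. \<not> (0 < a \<omega> \<and> a \<omega> \<le> b \<omega>)"
  \<comment> \<open>The same argument with the features exchanged, tilting \<open>f2\<close> towards
    \<open>f1\<close>.\<close>
  proof (rule ccontr)
    have "f2 \<bullet> f1 = 0"
      using fg(1) by (simp add: inner_commute)
    moreover assume "\<not> (AE \<omega> in M. \<not> (0 < a \<omega> \<and> a \<omega> \<le> b \<omega>))"
    ultimately show False
      using exists_better_than_separate[where tie = tie, OF _ fg(3,2) ab(2,1) nonneg(2,1) int(2,1) tie]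
        not_better by (simp add: add.commute min.commute)
  qed
  \<comment> \<open>When both features fire, both coordinates are positive almost surely, and one of
    the two orderings just excluded must hold.\<close>
  ultimately have "AE \<omega> in M. \<omega> \<notin> A1 \<inter> A2"
    using assms(9,10) by eventually_elim (auto simp: a_def b_def)
  then have "measure M (A1 \<inter> A2) = 0"
    using prob_eq_0[of "A1 \<inter> A2"] by simp
  \<comment> \<open>The bounds \<open>P1 + P2 + P12 \<le> 1\<close> and
    \<open>P1 + P2 + 2 * P12 > 1\<close> together force \<open>P12 > 0\<close>.\<close>
  with assms(15-17) show False
    by simp
qed

end
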